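(* In the setting of the context, fix $z\in\mathbb H$ and $\tau\in\mathbb R_{>0}$, and let $b=\tau^{-1}+2\tau$ and $m_b=\|\mathbb EL\|+sb+|z|+\tau+1$. Let $F^{(\tau)}\in\mathcal A_b=\{W\in\mathbb C^{\ell\times\ell}:\Im[W]\succ0,\ \|W\|<b\}$ and let $D^{(\tau)}$ be defined by $$(\mathbb EL-\mathcal S(F^{(\tau)})-z\Lambda-i\tau I_\ell)F^{(\tau)}=I_\ell+D^{(\tau)}.$$ Put $\epsilon_\tau=\|(\mathbb EL-\mathcal S(F^{(\tau)})-z\Lambda-i\tau I_\ell)^{-1}D^{(\tau)}\|$ and suppose $\epsilon_\tau<\tau m_b^{-2}$. Then $$\|M^{(\tau)}(z)-F^{(\tau)}\|\le2(\tau+\tau^{-1})\tanh\Big((1+\tau^2)(m_b^2\tau^{-2}-1)\,\mathrm{arctanh}\big(\epsilon_\tau m_b^2/\tau\big)\Big).$$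
   Context: Let $n,d\ge1$, $\ell=n+d$. For $W\in\mathbb C^{\ell\times\ell}$, $W_{1,1}$ denotes the upper-left $n\times n$ block. $\Im[W]=(W-W^* )/(2i)$; $\succeq,\succ$ is the Loewner order; $\|\cdot\|$ is the spectral norm. $\mathbb H$ is the open upper half-plane. $L=\begin{bmatrix}A&B^\top\\ B&Q\end{bmatrix}\in\mathbb R^{\ell\times\ell}$ is random real symmetric, $A\in\mathbb R^{n\times n}$ symmetric, $B\in\mathbb R^{d\times n}$, $Q\in\mathbb R^{d\times d}$ symmetric, $Q$ and $\mathbb EQ$ non-singular, entries with finite second moments. $\Lambda=\mathrm{diag}\{I_n,0_{d\times d}\}$. $\mathcal S:\mathbb C^{\ell\times\ell}\to\mathbb C^{\ell\times\ell}$ is a positivity-preserving linear map (maps positive semidefinite matrices to positive semidefinite matrices) of the form $$\mathcal S(M)=\begin{bmatrix}\mathcal S_{1,1}(M)&\mathbb E[(A-\mathbb EA)M_{1,1}(B-\mathbb EB)^\top]\\ \mathbb E[(B-\mathbb EB)M_{1,1}(A-\mathbb EA)]&\mathbb E[(B-\mathbb EB)M_{1,1}(B-\mathbb EB)^\top]\end{bmatrix}$$ with $\mathcal S_{1,1}:\mathbb C^{\ell\times\ell}\to\mathbb C^{n\times n}$ a given positivity-preserving linear map; expectations are over $L$ only. $s>0$ is a constant with $\|\mathcal S(W)\|\le s\|W\|$ for all $W$. $M^{(\tau)}$ is the unique holomorphic function $\mathbb H\to\{W\in\mathbb C^{\ell\times\ell}:\Im[W]\succ0\}$ with $(\mathbb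 EL-\mathcal S(M^{(\tau)}(z))-z\Lambda-i\tau I_\ell)M^{(\tau)}(z)=I_\ell$ for all $z\in\mathbb H$ (existence and uniqueness are known for $\tau>0$). *)

theory Defs
  imports "HOL-Probability.Probability" "HOL-Complex_Analysis.Complex_Analysis"
begin

text \<open>
  The index set of size $\ell = n + d$ is the sum type of the index types of the two blocks
  (so both block sizes are at least one).  In \<open>'a ^ 'c ^ 'r\<close> the rows are indexed by \<open>'r\<close>
  and the columns by \<open>'c\<close>.
\<close>

definition block_matrix ::
  "'a ^ 'n ^ 'n \<Rightarrow> 'a ^ 'd ^ 'n \<Rightarrow> 'a ^ 'n ^ 'd \<Rightarrow> 'a ^ 'd ^ 'd
     \<Rightarrow> 'a ^ ('n::finite + 'd::finite) ^ ('n + 'd)" where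
  "block_matrix X11 X12 X21 X22 =
     (\<chi> i j. case i of
        Inl a \<Rightarrow> (case j of Inl b \<Rightarrow> X11 $ a $ b | Inr b \<Rightarrow> X12 $ a $ b)
      | Inr a \<Rightarrow> (case j of Inl b \<Rightarrow> X21 $ a $ b | Inr b \<Rightarrow> X22 $ a $ b))"

definition block11 :: "'a ^ ('n::finite + 'd::finite) ^ ('n + 'd) \<Rightarrow> 'a ^ 'n ^ 'n" where
  "block11 W = (\<chi> i j. W $ Inl i $ Inl j)"

definition cmatrix :: "real ^ 'c ^ 'r \<Rightarrow> complex ^ 'c::finite ^ 'r::finite" where
  "cmatrix X = map_matrix complex_of_real X"

definition mscale :: "complex \<Rightarrow> complex ^ 'c ^ 'r \<Rightarrow> complex ^ 'c::finite ^ 'r::finite" where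
  "mscale c X = map_matrix (\<lambda>x. c * x) X"

definition ctranspose :: "complex ^ 'c ^ 'r \<Rightarrow> complex ^ 'r::finite ^ 'c::finite" where
  "ctranspose X = map_matrix cnj (transpose X)"

text \<open>The matrix imaginary part $(W - W^*)/(2i)$, not the entrywise one.\<close>

definition Im_matrix :: "complex ^ 'l ^ 'l \<Rightarrow> complex ^ 'l::finite ^ 'l" where
  "Im_matrix W = mscale (1 / (2 * \<i>)) (W - ctranspose W)"

definition quad_form :: "complex ^ 'l ^ 'l \<Rightarrow> complex ^ 'l::finite \<Rightarrow> complex" where
  "quad_form X v = (\<Sum>i\<in>UNIV. cnj (v $ i) * (X *v v) $ i)"

text \<open>
  Positivity $X \succeq 0$ and $X \succ 0$ in the Loewner order.  The quadratic form of a
  Hermitian matrix is real, so taking the real part loses nothing.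
\<close>

definition psd :: "complex ^ 'l ^ 'l::finite \<Rightarrow> bool" where
  "psd X \<longleftrightarrow> ctranspose X = X \<and> (\<forall>v. 0 \<le> Re (quad_form X v))"

definition pd :: "complex ^ 'l ^ 'l::finite \<Rightarrow> bool" where
  "pd X \<longleftrightarrow> ctranspose X = X \<and> (\<forall>v. v \<noteq> 0 \<longrightarrow> 0 < Re (quad_form X v))"

text \<open>
  The instance \<open>norm\<close> on matrices is the Frobenius norm; the spectral norm is the operator norm
  for the Euclidean norm on vectors.
\<close>

definition spectral_norm :: "complex ^ 'c ^ 'r \<Rightarrow> real" where
  "spectral_norm (W :: complex ^ 'c::finite ^ 'r::finite) = onorm (\<lambda>v. W *v v)"

definition matrix_clinear ::
  "(complex ^ 'c ^ 'r \<Rightarrow> complex ^ 'e ^ 'f) \<Rightarrow> bool" where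
  "matrix_clinear (T :: complex ^ 'c::finite ^ 'r::finite \<Rightarrow> complex ^ 'e::finite ^ 'f::finite)
     \<longleftrightarrow> (\<forall>X Y. T (X + Y) = T X + T Y) \<and> (\<forall>c X. T (mscale c X) = mscale c (T X))"

definition positivity_preserving ::
  "(complex ^ 'l ^ 'l \<Rightarrow> complex ^ 'k ^ 'k) \<Rightarrow> bool" where
  "positivity_preserving (T :: complex ^ 'l ^ 'l::finite \<Rightarrow> complex ^ 'k ^ 'k::finite)
     \<longleftrightarrow> (\<forall>X. psd X \<longrightarrow> psd (T X))"

definition Lambda :: "complex ^ ('n::finite + 'd::finite) ^ ('n + 'd)" where
  "Lambda = block_matrix (mat 1) 0 0 0"

text \<open>
  $E - \mathcal S(W) - z\Lambda - i\tau I_\ell$; the parameter \<open>E\<close> is instantiated with the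
  expectation of $L$.
\<close>

definition mde_op ::
  "complex ^ ('n + 'd) ^ ('n + 'd)
     \<Rightarrow> (complex ^ ('n + 'd) ^ ('n + 'd) \<Rightarrow> complex ^ ('n + 'd) ^ ('n + 'd))
     \<Rightarrow> complex \<Rightarrow> real \<Rightarrow> complex ^ ('n + 'd) ^ ('n + 'd)
     \<Rightarrow> complex ^ ('n::finite + 'd::finite) ^ ('n + 'd)" where
  "mde_op E S z \<tau> W = E - S W - mscale z Lambda - mscale (\<i> * of_real \<tau>) (mat 1)"

text \<open>
  For \<open>\<tau> > 0\<close> the map $M^{(\tau)}$ is the unique holomorphic solution on the upper half-plane;
  functions are total here, so a solution is only determined on that half-plane.
\<close>

definition mde_solution ::
  "complex ^ ('n + 'd) ^ ('n + 'd)
     \<Rightarrow> (complex ^ ('n + 'd) ^ ('n + 'd) \<Rightarrow> complex ^ ('n + 'd) ^ ('n + 'd))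
     \<Rightarrow> real \<Rightarrow> (complex \<Rightarrow> complex ^ ('n::finite + 'd::finite) ^ ('n + 'd)) \<Rightarrow> bool" where
  "mde_solution E S \<tau> M \<longleftrightarrow>
     (\<forall>i j. (\<lambda>z. M z $ i $ j) holomorphic_on {z. 0 < Im z}) \<and>
     (\<forall>z. 0 < Im z \<longrightarrow> pd (Im_matrix (M z)) \<and> mde_op E S z \<tau> (M z) ** M z = mat 1)"

end

theory Submission
  imports Defs
begin

text \<open>
  Let \<open>\<Phi>(W)\<close> be the inverse of \<open>EL - S W - z \<Lambda> - \<i> \<tau>\<close> and \<open>\<delta> = F - \<Phi>(F)\<close>, so that
  \<open>\<epsilon>\<close> is the norm of \<open>\<delta>\<close>.  On $\mathcal A_b$ the imaginary part of \<open>\<Phi>(W)\<close> is at least $\tau / m_b^2$,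
  hence for $|\zeta| < R = \tau / (m_b^2 \epsilon)$ the map \<open>W \<mapsto> \<Phi>(W) + \<zeta> \<delta>\<close> preserves
  $\mathcal A_b$.  Its iterates started at \<open>F\<close> are holomorphic in \<open>\<zeta>\<close>, equal \<open>F\<close> at \<open>\<zeta> = 1\<close> and
  converge to \<open>M(z)\<close> at \<open>\<zeta> = 0\<close>, so the Schwarz lemma yields the distance bound
  $(b + \tau^{-1}) / R = 2 (\tau + \tau^{-1}) \, \epsilon m_b^2 / \tau$.  It is sharper than the stated one,
  because the factor in front of the inverse hyperbolic tangent is at least 1.
\<close>

no_notation fps_nth (infixl \<open>$\<close> 75)

section \<open>Complex inner product, quadratic forms and the matrix imaginary part\<close>

definition cinner :: "complex ^ 'n \<Rightarrow> complex ^ 'n::finite \<Rightarrow> complex" where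
  "cinner u v = (\<Sum>i\<in>UNIV. cnj (u $ i) * v $ i)"

lemma quad_form_cinner: "quad_form X v = cinner v (X *v v)"
  by (simp add: quad_form_def cinner_def)

lemma cinner_add: "cinner u (x + y) = cinner u x + cinner u y"
  by (simp add: cinner_def distrib_left sum.distrib)

lemma cinner_diff: "cinner u (x - y) = cinner u x - cinner u y"
  by (simp add: cinner_def right_diff_distrib sum_subtractf)

lemma cinner_scale: "cinner u (c *s x) = c * cinner u x"
  by (simp add: cinner_def sum_distrib_left mult.left_commute)

lemma cinner_commute: "cinner u v = cnj (cinner v u)"
  by (simp add: cinner_def mult.commute)

lemma cinner_same: "cinner v v = of_real ((norm v)\<^sup>2)"
  by (simp add: cinner_def norm_vec_def L2_set_def sum_nonneg complex_norm_square[symmetric] mult.commute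
      del: of_real_power)

lemma norm_cinner_le: "cmod (cinner u v) \<le> norm u * norm v"
proof -
  have "cmod (cinner u v) \<le> (\<Sum>i\<in>UNIV. \<bar>cmod (u $ i)\<bar> * \<bar>cmod (v $ i)\<bar>)"
    unfolding cinner_def by (rule order_trans[OF norm_sum]) (simp add: norm_mult)
  also have "\<dots> \<le> norm u * norm v"
    unfolding norm_vec_def by (rule L2_set_mult_ineq)
  finally show ?thesis .
qed

lemma norm_scale_vec: "norm (c *s v) = cmod c * norm (v :: complex ^ 'n::finite)"
  unfolding norm_vec_def by (simp add: norm_mult L2_set_right_distrib)

lemma mscale_mult_vec: "mscale c X *v v = c *s (X *v v)"
  by (simp add: mscale_def map_matrix_def matrix_vector_mult_def vec_eq_iff sum_distrib_left mult.assoc)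

lemma mscale_nth [simp]: "mscale c X $ i $ j = c * X $ i $ j"
  by (simp add: mscale_def map_matrix_def)

lemma ctranspose_nth [simp]: "ctranspose X $ i $ j = cnj (X $ j $ i)"
  by (simp add: ctranspose_def map_matrix_def transpose_def)

lemma cinner_ctranspose: "cinner u (ctranspose X *v v) = cinner (X *v u) v"
proof -
  have "cinner u (ctranspose X *v v) = (\<Sum>i\<in>UNIV. \<Sum>j\<in>UNIV. cnj (u $ i) * (cnj (X $ j $ i) * v $ j))"
    by (simp add: cinner_def matrix_vector_mult_def sum_distrib_left)
  also have "\<dots> = (\<Sum>j\<in>UNIV. \<Sum>i\<in>UNIV. cnj (u $ i) * (cnj (X $ j $ i) * v $ j))"
    by (rule sum.swap)
  also have "\<dots> = cinner (X *v u) v"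
    by (simp add: cinner_def matrix_vector_mult_def sum_distrib_left sum_distrib_right mult_ac)
  finally show ?thesis .
qed

lemma quad_form_add: "quad_form (X + Y) v = quad_form X v + quad_form Y v"
  by (simp add: quad_form_cinner matrix_vector_mult_add_rdistrib cinner_add)

lemma quad_form_diff: "quad_form (X - Y) v = quad_form X v - quad_form Y v"
  by (simp add: quad_form_cinner matrix_vector_mult_diff_rdistrib cinner_diff)

lemma quad_form_mscale: "quad_form (mscale c X) v = c * quad_form X v"
  by (simp add: quad_form_cinner mscale_mult_vec cinner_scale)

lemma quad_form_mat_1: "quad_form (mat 1) v = of_real ((norm v)\<^sup>2)"
  by (simp add: quad_form_cinner cinner_same)

lemma quad_form_ctranspose: "quad_form (ctranspose X) v = cnj (quad_form X v)"
  by (metis quad_form_cinner cinner_ctranspose cinner_commute)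

lemma quad_form_Im_matrix: "quad_form (Im_matrix W) v = of_real (Im (quad_form W v))"
  by (simp add: Im_matrix_def quad_form_mscale quad_form_diff quad_form_ctranspose complex_eq_iff)

lemma ctranspose_Im_matrix: "ctranspose (Im_matrix W) = Im_matrix W"
  by (simp add: vec_eq_iff Im_matrix_def complex_eq_iff divide_simps)

lemma pd_Im_matrix_iff: "pd (Im_matrix W) \<longleftrightarrow> (\<forall>v. v \<noteq> 0 \<longrightarrow> 0 < Im (quad_form W v))"
  by (simp add: pd_def ctranspose_Im_matrix quad_form_Im_matrix)

lemma psd_Im_matrix: "pd (Im_matrix W) \<Longrightarrow> psd (Im_matrix W)"
  unfolding psd_def pd_def
  by (metis cinner_same less_eq_real_def mult_zero_left matrix_vector_mult_0_right quad_form_cinner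
      cinner_scale Re_complex_of_real norm_zero zero_power2)

section \<open>The spectral norm\<close>

lemma bounded_linear_mult_vec: "bounded_linear (\<lambda>v. X *v v)"
  for X :: "complex ^ 'c::finite ^ 'r::finite"
proof -
  have "linear (\<lambda>v. X *v v)"
    by (rule linearI)
       (simp_all add: vec_eq_iff matrix_vector_mult_def scaleR_sum_right distrib_left sum.distrib)
  then show ?thesis by (simp add: linear_conv_bounded_linear)
qed

lemma norm_mult_vec_le: "norm (X *v v) \<le> spectral_norm X * norm v"
  unfolding spectral_norm_def by (rule onorm[OF bounded_linear_mult_vec])

lemma spectral_norm_leI: "(\<And>v. norm (X *v v) \<le> c * norm v) \<Longrightarrow> spectral_norm X \<le> c"
  unfolding spectral_norm_def by (rule onorm_le)

lemma spectral_norm_nonneg: "0 \<le> spectral_norm X"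
  unfolding spectral_norm_def by (rule onorm_pos_le[OF bounded_linear_mult_vec])

lemma spectral_norm_add_le: "spectral_norm (X + Y) \<le> spectral_norm X + spectral_norm Y"
  unfolding spectral_norm_def matrix_vector_mult_add_rdistrib
  by (rule onorm_triangle[OF bounded_linear_mult_vec bounded_linear_mult_vec])

lemma spectral_norm_mult_le: "spectral_norm (X ** Y) \<le> spectral_norm X * spectral_norm Y"
  unfolding spectral_norm_def
  using onorm_compose[OF bounded_linear_mult_vec bounded_linear_mult_vec, of X Y]
  by (simp add: o_def matrix_vector_mul_assoc)

lemma spectral_norm_mscale_le: "spectral_norm (mscale c X) \<le> cmod c * spectral_norm X"
  by (rule spectral_norm_leI)
     (simp add: mscale_mult_vec norm_scale_vec mult.assoc mult_left_mono norm_mult_vec_le)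

lemma spectral_norm_diff_le: "spectral_norm (X - Y) \<le> spectral_norm X + spectral_norm Y"
proof -
  have eq: "X - Y = X + mscale (-1) Y" by (simp add: vec_eq_iff)
  show ?thesis
    unfolding eq
    using spectral_norm_add_le[of X "mscale (-1) Y"] spectral_norm_mscale_le[of "-1" Y] by simp
qed

lemma norm_cinner_mult_le: "cmod (cinner u (X *v v)) \<le> spectral_norm X * (norm u * norm v)"
  using order_trans[OF norm_cinner_le mult_left_mono[OF norm_mult_vec_le norm_ge_zero], of u X v]
  by (simp add: mult_ac)

text \<open>Testing with \<open>u = X *v v\<close> recovers the norm of \<open>X *v v\<close>. This
  reduces a matrix estimate to scalar functions, to which the Schwarz lemma applies.\<close>

lemma spectral_norm_le_cinnerI:
  fixes X :: "complex ^ 'c::finite ^ 'r::finite"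
  assumes "\<And>u v. cmod (cinner u (X *v v)) \<le> c * (norm u * norm v)"
  shows "spectral_norm X \<le> c"
proof (rule spectral_norm_leI)
  fix v
  show "norm (X *v v) \<le> c * norm v"
  proof (cases "X *v v = 0")
    case True
    \<comment> \<open>The sign of \<open>c\<close> is not known beforehand, so some nonzero
      \<open>u\<close> is put into the hypothesis to obtain
      \<open>0 \<le> c * norm v\<close>.\<close>
    define u :: "complex ^ 'r" where "u = (\<chi> i. 1)"
    have "0 < norm u" by (simp add: u_def vec_eq_iff)
    moreover have "0 \<le> norm u * (c * norm v)"
      using order_trans[OF norm_ge_zero assms[of u v]] by (simp add: mult.left_commute)
    ultimately have "0 \<le> c * norm v"
      by (metis mult_le_cancel_left_pos mult_zero_right)
    with True show ?thesis by simp
  next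
    case False
    have "norm (X *v v) * norm (X *v v) \<le> norm (X *v v) * (c * norm v)"
      using assms[of "X *v v" v] unfolding cinner_same
      by (simp add: power2_eq_square norm_mult mult_ac)
    then show ?thesis using False by simp
  qed
qed

section \<open>Inverses of matrices with negative imaginary part\<close>

lemma invertible_if_bounded_below:
  fixes N :: "complex ^ 'l ^ 'l::finite"
  assumes "0 < t" "\<And>v. t * norm v \<le> norm (N *v v)"
  shows "invertible N"
proof -
  have "\<forall>x. N *v x = 0 \<longrightarrow> x = 0"
    using assms by (metis mult_le_0_iff norm_eq_zero norm_le_zero_iff not_le)
  then show ?thesis
    by (metis matrix_left_invertible_ker invertible_left_inverse)
qed

lemma matrix_inv_mult:
  assumes "invertible N"
  shows "N ** matrix_inv N = mat 1" "matrix_inv N ** N = mat 1"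
  using someI_ex[OF assms[unfolded invertible_def]] by (simp_all add: matrix_inv_def)

lemma matrix_inv_mult_vec:
  assumes "invertible N"
  shows "N *v (matrix_inv N *v v) = v" "matrix_inv N *v (N *v v) = v"
  by (simp_all add: assms matrix_vector_mul_assoc matrix_inv_mult)

text \<open>The second resolvent identity, the source of the Lipschitz bound for the resolvent
  map.\<close>

lemma matrix_inv_diff:
  fixes A B :: "complex ^ 'l ^ 'l::finite"
  assumes "invertible A" "invertible B"
  shows "matrix_inv A - matrix_inv B = matrix_inv A ** (B - A) ** matrix_inv B"
  unfolding matrix_eq matrix_vector_mul_assoc[symmetric] matrix_vector_mult_diff_rdistrib
    matrix_vector_mult_diff_distrib
  by (simp add: assms matrix_inv_mult_vec)

text \<open>The Loewner bound Im N \<le> -t. The sign is that of the term -i \<tau> in the equation;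
  inversion turns it into a positive imaginary part.\<close>

definition dissipative :: "real \<Rightarrow> complex ^ 'l ^ 'l::finite \<Rightarrow> bool" where
  "dissipative t N \<longleftrightarrow> (\<forall>v. Im (quad_form N v) \<le> - t * (norm v)\<^sup>2)"

text \<open>Cauchy-Schwarz: the modulus of the form at \<open>v\<close> is at least
  \<open>t * (norm v)\<^sup>2\<close> and at most \<open>norm v * norm (N *v v)\<close>.\<close>

lemma dissipative_bounded_below:
  assumes "dissipative t N"
  shows "t * norm v \<le> norm (N *v v)"
proof -
  have "t * (norm v)\<^sup>2 \<le> \<bar>Im (quad_form N v)\<bar>"
    using assms[unfolded dissipative_def, rule_format, of v] by linarith
  also have "\<dots> \<le> cmod (quad_form N v)" by (rule abs_Im_le_cmod)
  also have "\<dots> \<le> norm v * norm (N *v v)" unfolding quad_form_cinner by (rule norm_cinner_le)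
  finally have "norm v * (t * norm v) \<le> norm v * norm (N *v v)"
    by (simp add: power2_eq_square mult_ac)
  then show ?thesis by (cases "v = 0") auto
qed

lemma dissipative_invertible: "0 < t \<Longrightarrow> dissipative t N \<Longrightarrow> invertible N"
  using invertible_if_bounded_below dissipative_bounded_below by blast

lemma spectral_norm_inv_dissipative:
  assumes "0 < t" "dissipative t N"
  shows "spectral_norm (matrix_inv N) \<le> 1 / t"
proof (rule spectral_norm_leI)
  fix v
  show "norm (matrix_inv N *v v) \<le> 1 / t * norm v"
    using dissipative_bounded_below[OF assms(2), of "matrix_inv N *v v"] assms(1)
    by (simp add: matrix_inv_mult_vec dissipative_invertible[OF assms] field_simps)
qed

text \<open>With \<open>v = matrix_inv N *v u\<close>, the form of the inverse at \<open>u\<close>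
  is the conjugate of the form of \<open>N\<close> at \<open>v\<close>, so inversion flips the sign
  of the imaginary part.\<close>

lemma Im_quad_form_inv:
  assumes "0 < t" "dissipative t N"
  shows "t * (norm (matrix_inv N *v u))\<^sup>2 \<le> Im (quad_form (matrix_inv N) u)"
proof -
  define v where "v = matrix_inv N *v u"
  have u: "N *v v = u" by (simp add: v_def matrix_inv_mult_vec dissipative_invertible[OF assms])
  have "quad_form (matrix_inv N) u = cnj (quad_form N v)"
    unfolding quad_form_cinner v_def[symmetric] u by (rule cinner_commute)
  then show ?thesis
    using assms(2)[unfolded dissipative_def, rule_format, of v] by (simp add: v_def)
qed

lemma pd_Im_matrix_inv:
  assumes "0 < t" "dissipative t N"
  shows "pd (Im_matrix (matrix_inv N))"
  unfolding pd_Im_matrix_iff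
proof safe
  fix v :: "complex ^ 'a" assume "v \<noteq> 0"
  then have "matrix_inv N *v v \<noteq> 0"
    by (metis matrix_inv_mult_vec(1) dissipative_invertible[OF assms] matrix_vector_mult_0_right)
  then have "0 < t * (norm (matrix_inv N *v v))\<^sup>2" using assms(1) by simp
  with Im_quad_form_inv[OF assms, of v] show "0 < Im (quad_form (matrix_inv N) v)" by linarith
qed

text \<open>Since \<open>norm u \<le> m * norm (matrix_inv N *v u)\<close>, the bound of
  \<open>Im_quad_form_inv\<close> becomes uniform in \<open>u\<close>. The margin
  \<open>t / m\<^sup>2\<close> is the room left for perturbing the resolvent map.\<close>

lemma Im_quad_form_inv_ge:
  assumes "0 < t" "dissipative t N" "0 < m" "spectral_norm N \<le> m"
  shows "t / m\<^sup>2 * (norm u)\<^sup>2 \<le> Im (quad_form (matrix_inv N) u)"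
proof -
  define v where "v = matrix_inv N *v u"
  have u: "N *v v = u" by (simp add: v_def matrix_inv_mult_vec dissipative_invertible[OF assms(1,2)])
  have "norm u \<le> m * norm v"
    using order_trans[OF norm_mult_vec_le mult_right_mono[OF assms(4) norm_ge_zero], of v] u by simp
  then have "(norm u)\<^sup>2 \<le> m\<^sup>2 * (norm v)\<^sup>2"
    using power_mono[of "norm u" "m * norm v" 2] by (simp add: power_mult_distrib)
  then have "t / m\<^sup>2 * (norm u)\<^sup>2 \<le> t / m\<^sup>2 * (m\<^sup>2 * (norm v)\<^sup>2)"
    using assms(1) by (intro mult_left_mono) auto
  also have "\<dots> = t * (norm v)\<^sup>2" using assms(3) by simp
  also have "\<dots> \<le> Im (quad_form (matrix_inv N) u)"
    unfolding v_def by (rule Im_quad_form_inv[OF assms(1,2)])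
  finally show ?thesis .
qed

section \<open>Positivity-preserving maps and the imaginary part\<close>

lemma Im_quad_form_hermitian: "ctranspose X = X \<Longrightarrow> Im (quad_form X v) = 0"
  by (metis quad_form_ctranspose complex_cnj_cancel_iff Reals_cnj_iff complex_is_Real_iff)

text \<open>The form of \<open>X\<close> is at least minus the spectral norm. It serves to write a
  Hermitian matrix as a difference of two positive semidefinite ones.\<close>

lemma psd_shift_hermitian:
  assumes "ctranspose X = X"
  shows "psd (X + mscale (of_real (spectral_norm X)) (mat 1))"
  unfolding psd_def
proof safe
  show "ctranspose (X + mscale (complex_of_real (spectral_norm X)) (mat 1))
      = X + mscale (complex_of_real (spectral_norm X)) (mat 1)"
    using assms by (auto simp: vec_eq_iff mat_def)
  fix v :: "complex ^ 'a"
  have "- Re (quad_form X v) \<le> cmod (quad_form X v)"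
    by (metis abs_Re_le_cmod abs_le_D2)
  also have "\<dots> \<le> spectral_norm X * (norm v)\<^sup>2"
    unfolding quad_form_cinner using norm_cinner_mult_le[of v X v] by (simp add: power2_eq_square)
  finally show "0 \<le> Re (quad_form (X + mscale (complex_of_real (spectral_norm X)) (mat 1)) v)"
    by (simp add: quad_form_add quad_form_mscale quad_form_mat_1 del: of_real_power)
qed

lemma matrix_clinear_diff:
  assumes "matrix_clinear T"
  shows "T (X - Y) = T X - T Y"
proof -
  have "T ((X - Y) + Y) = T (X - Y) + T Y"
    using assms unfolding matrix_clinear_def by blast
  then show ?thesis by simp
qed

text \<open>\<open>X\<close> is the difference of the positive semidefinite matrices
  \<open>X + c\<close> and \<open>c\<close>, whose images are again Hermitian.\<close>

lemma Im_quad_form_image_hermitian: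
  assumes "matrix_clinear T" "positivity_preserving T" "ctranspose X = X"
  shows "Im (quad_form (T X) v) = 0"
proof -
  define c where "c = mscale (of_real (spectral_norm X)) (mat 1 :: complex ^ 'a ^ 'a)"
  have "ctranspose c = c"
    by (simp add: c_def vec_eq_iff mat_def)
  then have c: "psd c"
    by (simp add: psd_def c_def quad_form_mscale quad_form_mat_1 spectral_norm_nonneg
        del: of_real_power)
  have "psd (T (X + c))" "psd (T c)"
    using assms(2) psd_shift_hermitian[OF assms(3)] c unfolding positivity_preserving_def c_def
    by blast+
  then have "Im (quad_form (T (X + c)) v) = 0" "Im (quad_form (T c) v) = 0"
    using Im_quad_form_hermitian unfolding psd_def by blast+
  then show ?thesis
    using assms(1) by (simp add: matrix_clinear_def quad_form_add)
qed

text \<open>Split \<open>W = R + \<i> Im W\<close> with \<open>R\<close> Hermitian: the image of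
  \<open>R\<close> has a real form, and the image of the positive matrix Im W supplies the imaginary
  part.\<close>

lemma Im_quad_form_image_nonneg:
  assumes "matrix_clinear T" "positivity_preserving T" "pd (Im_matrix W)"
  shows "0 \<le> Im (quad_form (T W) v)"
proof -
  define R where "R = mscale (1 / 2) (W + ctranspose W)"
  have W: "W = R + mscale \<i> (Im_matrix W)"
    by (simp add: vec_eq_iff R_def Im_matrix_def complex_eq_iff field_simps)
  have "T W = T R + mscale \<i> (T (Im_matrix W))"
    using assms(1) by (subst W) (simp add: matrix_clinear_def)
  then have "quad_form (T W) v = quad_form (T R) v + \<i> * quad_form (T (Im_matrix W)) v"
    by (simp add: quad_form_add quad_form_mscale)
  moreover have "Im (quad_form (T R) v) = 0"
    by (rule Im_quad_form_image_hermitian[OF assms(1,2)]) (simp add: vec_eq_iff R_def)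
  moreover have "0 \<le> Re (quad_form (T (Im_matrix W)) v)"
    using assms(2) psd_Im_matrix[OF assms(3)] unfolding positivity_preserving_def psd_def by blast
  ultimately show ?thesis by simp
qed


section \<open>Matrix-valued holomorphic functions\<close>

definition matrix_holomorphic_on ::
  "(complex \<Rightarrow> complex ^ 'c ^ 'r) \<Rightarrow> complex set \<Rightarrow> bool" where
  "matrix_holomorphic_on (G :: complex \<Rightarrow> complex ^ 'c::finite ^ 'r::finite) U
     \<longleftrightarrow> (\<forall>i j. (\<lambda>t. G t $ i $ j) holomorphic_on U)"

lemma matrix_holomorphic_on_const: "matrix_holomorphic_on (\<lambda>t. X) U"
  by (simp add: matrix_holomorphic_on_def)

lemma matrix_holomorphic_on_add:
  "matrix_holomorphic_on F U \<Longrightarrow> matrix_holomorphic_on G U \<Longrightarrow> matrix_holomorphic_on (\<lambda>t. F t + G t) U"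
  by (simp add: matrix_holomorphic_on_def holomorphic_intros)

lemma matrix_holomorphic_on_diff:
  "matrix_holomorphic_on F U \<Longrightarrow> matrix_holomorphic_on G U \<Longrightarrow> matrix_holomorphic_on (\<lambda>t. F t - G t) U"
  by (simp add: matrix_holomorphic_on_def holomorphic_intros)

lemma matrix_holomorphic_on_mscale:
  "f holomorphic_on U \<Longrightarrow> matrix_holomorphic_on (\<lambda>t. mscale (f t) X) U"
  by (simp add: matrix_holomorphic_on_def holomorphic_intros)

lemma holomorphic_on_det:
  "matrix_holomorphic_on G U \<Longrightarrow> (\<lambda>t. det (G t)) holomorphic_on U"
  unfolding det_def matrix_holomorphic_on_def by (intro holomorphic_intros) auto

lemma holomorphic_on_cinner:
  "matrix_holomorphic_on G U \<Longrightarrow> (\<lambda>t. cinner u (G t *v v)) holomorphic_on U"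
  unfolding cinner_def matrix_vector_mult_def matrix_holomorphic_on_def
  by (auto intro!: holomorphic_intros)

text \<open>Cramer's rule for the system whose right-hand side is \<open>axis j 1\<close>. It
  exhibits the entries of the inverse as quotients of determinants, hence as holomorphic functions
  of the entries.\<close>

lemma matrix_inv_nth:
  fixes N :: "complex ^ 'l ^ 'l::finite"
  assumes "invertible N"
  shows "matrix_inv N $ i $ j = det (\<chi> a b. if b = i then axis j 1 $ a else N $ a $ b) / det N"
proof -
  have "det N \<noteq> 0" using assms by (simp add: invertible_det_nz)
  from cramer[OF this] matrix_inv_mult_vec(1)[OF assms, of "axis j 1"]
  have "matrix_inv N *v axis j 1
      = (\<chi> k. det (\<chi> a b. if b = k then axis j 1 $ a else N $ a $ b) / det N)"
    by blast
  moreover have "(matrix_inv N *v axis j 1) $ i = matrix_inv N $ i $ j"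
    by (simp add: matrix_vector_mult_def axis_def if_distrib cong: if_cong)
  ultimately show ?thesis by simp
qed

lemma matrix_holomorphic_on_inv:
  fixes G :: "complex \<Rightarrow> complex ^ 'n ^ 'n::finite"
  assumes "matrix_holomorphic_on G U" "\<And>t. t \<in> U \<Longrightarrow> invertible (G t)"
  shows "matrix_holomorphic_on (\<lambda>t. matrix_inv (G t)) U"
  unfolding matrix_holomorphic_on_def
proof safe
  fix i j
  have "(\<lambda>t. det ((\<chi> a b. if b = i then axis j 1 $ a else G t $ a $ b) :: complex ^ 'n ^ 'n) / det (G t)) holomorphic_on U"
  proof (intro holomorphic_on_divide holomorphic_on_det assms(1))
    show "matrix_holomorphic_on (\<lambda>t. (\<chi> a b. if b = i then axis j 1 $ a else G t $ a $ b) :: complex ^ 'n ^ 'n) U"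
      unfolding matrix_holomorphic_on_def
    proof safe
      fix a c
      show "(\<lambda>t. (\<chi> a b. if b = i then axis j 1 $ a else G t $ a $ b) $ a $ c) holomorphic_on U"
        using assms(1) by (cases "c = i") (simp_all add: matrix_holomorphic_on_def)
    qed
    show "det (G t) \<noteq> 0" if "t \<in> U" for t
      using assms(2)[OF that] by (simp add: invertible_det_nz)
  qed
  then show "(\<lambda>t. matrix_inv (G t) $ i $ j) holomorphic_on U"
    using assms(2) by (simp add: matrix_inv_nth cong: holomorphic_cong)
qed

lemma matrix_clinear_sum:
  assumes "matrix_clinear T"
  shows "T (\<Sum>x\<in>A. f x) = (\<Sum>x\<in>A. T (f x))"
proof (induction A rule: infinite_finite_induct)
  case (insert x A)
  then show ?case using assms by (simp add: matrix_clinear_def)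
\<comment> \<open>The empty sum, and the sum over an infinite set, which is zero by convention, both
  need \<open>T 0 = 0\<close>; this comes from \<open>T (0 - 0)\<close>.\<close>
qed (use matrix_clinear_diff[OF assms, of 0 0] in auto)

text \<open>Expanding \<open>G t\<close> in the matrix units \<open>E i j\<close> turns the image
  into a fixed linear combination of the holomorphic entries.\<close>

lemma matrix_holomorphic_on_clinear:
  assumes "matrix_clinear T" "matrix_holomorphic_on G U"
  shows "matrix_holomorphic_on (\<lambda>t. T (G t)) U"
proof -
  define E :: "'b \<Rightarrow> 'a \<Rightarrow> complex ^ 'a ^ 'b"
    where "E i j = (\<chi> a b. if a = i \<and> b = j then 1 else 0)" for i j
  have G: "G t = (\<Sum>i\<in>UNIV. \<Sum>j\<in>UNIV. mscale (G t $ i $ j) (E i j))" for t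
  proof -
    have "(\<Sum>j\<in>UNIV. mscale (G t $ i $ j) (E i j)) $ a $ b = (if a = i then G t $ a $ b else 0)"
      for a b i
      by (cases "a = i") (simp_all add: E_def mult_delta_right)
    then show ?thesis by (simp add: vec_eq_iff)
  qed
  have T: "T (G t) = (\<Sum>i\<in>UNIV. \<Sum>j\<in>UNIV. mscale (G t $ i $ j) (T (E i j)))" for t
    using assms(1) by (subst G) (simp add: matrix_clinear_sum[OF assms(1)] matrix_clinear_def)
  show ?thesis
    unfolding matrix_holomorphic_on_def T
    using assms(2) by (auto simp: matrix_holomorphic_on_def intro!: holomorphic_intros)
qed

section \<open>Normal families and the Schwarz lemma\<close>

text \<open>A form of Vitali's theorem. If convergence failed at \<open>w\<close>, a subsequence
  would stay away from 0 there; by Montel it has a convergent subsequence with holomorphic limit,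
  which vanishes on \<open>V\<close> and hence on \<open>S\<close> by the identity theorem.\<close>

lemma vitali_tendsto_0:
  assumes S: "open S" "connected S"
    and hol: "\<And>k. f k holomorphic_on S"
    and bdd: "\<And>K. compact K \<Longrightarrow> K \<subseteq> S \<Longrightarrow> \<exists>B. \<forall>k. \<forall>z\<in>K. cmod (f k z) \<le> B"
    and V: "open V" "V \<noteq> {}" "V \<subseteq> S" "\<And>z. z \<in> V \<Longrightarrow> (\<lambda>k. f k z) \<longlonglongrightarrow> 0"
    and w: "w \<in> S"
  shows "(\<lambda>k. f k w) \<longlonglongrightarrow> 0"
proof (rule ccontr)
  assume "\<not> ?thesis"
  then obtain e where e: "e > 0" "\<And>N. \<exists>k\<ge>N. e \<le> cmod (f k w)"
    unfolding LIMSEQ_iff by (metis diff_zero not_less)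
  then have "infinite {k. e \<le> cmod (f k w)}"
    unfolding infinite_nat_iff_unbounded_le by simp
  then obtain q :: "nat \<Rightarrow> nat" where q: "strict_mono q" "\<And>n. e \<le> cmod (f (q n) w)"
    using infinite_enumerate by (metis mem_Collect_eq)
  obtain g r where g: "g holomorphic_on S" "strict_mono (r :: nat \<Rightarrow> nat)"
    "\<And>z. z \<in> S \<Longrightarrow> (\<lambda>n. f (q (r n)) z) \<longlonglongrightarrow> g z"
  proof (rule Montel[of S "range f" "\<lambda>n. f (q n)"])
    show "\<exists>B. \<forall>h\<in>range f. \<forall>z\<in>K. cmod (h z) \<le> B" if "compact K" "K \<subseteq> S" for K
      using bdd[OF that] by auto
  qed (use S hol in auto)
  have "g w = 0"
  proof (rule analytic_continuation_open[of V S g "\<lambda>_. 0"])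
    fix z assume z: "z \<in> V"
    have "(\<lambda>n. f (q (r n)) z) \<longlonglongrightarrow> 0"
      using LIMSEQ_subseq_LIMSEQ[OF V(4)[OF z] strict_mono_o[OF q(1) g(2)]] by (simp add: o_def)
    then show "g z = 0"
      using g(3) z V(3) LIMSEQ_unique by blast
  qed (use V S g w in auto)
  then have "(\<lambda>n. cmod (f (q (r n)) w)) \<longlonglongrightarrow> 0"
    using g(3)[OF w] by (simp add: tendsto_norm_zero)
  then have "e \<le> 0"
    by (rule tendsto_lowerbound) (use q(2) in auto)
  with e(1) show False by simp
qed

text \<open>The Schwarz lemma for the rescaled map \<open>g\<close>, which sends the unit disc to
  itself and fixes 0, evaluated at \<open>1 / R\<close>.\<close>

lemma schwarz_increment:
  assumes "f holomorphic_on ball 0 R" "1 < R"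
    and "\<And>t. cmod t < R \<Longrightarrow> cmod (f t - f 0) < c"
  shows "cmod (f 1 - f 0) \<le> c / R"
proof -
  have c: "0 < c" using assms(2) assms(3)[of 0] by simp
  define g where "g t = (f (of_real R * t) - f 0) / of_real c" for t
  have "cmod (g (1 / of_real R)) \<le> cmod (1 / of_real R)"
  proof (rule Schwarz_Lemma(1))
    have "f \<circ> (\<lambda>t. of_real R * t) holomorphic_on ball 0 1"
      by (rule holomorphic_on_compose_gen[OF _ assms(1)])
         (use assms(2) in \<open>auto intro!: holomorphic_intros simp: norm_mult\<close>)
    then have hol: "(\<lambda>t. f (of_real R * t)) holomorphic_on ball 0 1"
      by (simp add: o_def)
    show "g holomorphic_on ball 0 1"
      unfolding g_def using c by (intro holomorphic_intros hol) auto
    show "cmod (g t) < 1" if "cmod t < 1" for t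
      using assms(2) assms(3)[of "of_real R * t"] that c
      by (simp add: g_def norm_divide norm_mult)
  qed (use assms(2) in \<open>auto simp: g_def norm_divide\<close>)
  then show ?thesis
    using assms(2) c by (simp add: g_def norm_divide field_simps)
qed


section \<open>The resolvent map, its iterates and its fixed point\<close>

locale mde_map =
  fixes S :: "complex ^ 'l ^ 'l::finite \<Rightarrow> complex ^ 'l ^ 'l" and s :: real
  assumes clinear: "matrix_clinear S"
    and positive: "positivity_preserving S"
    and bounded: "spectral_norm (S W) \<le> s * spectral_norm W"
begin

text \<open>The argument \<open>H\<close> collects everything in the equation except
  \<open>S W\<close>, so that a spectral parameter in it can vary.\<close>

definition resolvent :: "complex ^ 'l ^ 'l \<Rightarrow> complex ^ 'l ^ 'l \<Rightarrow> complex ^ 'l ^ 'l" where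
  "resolvent H W = matrix_inv (H - S W)"

text \<open>The form of \<open>S W\<close> has nonnegative imaginary part, so subtracting
  \<open>S W\<close> can only lower that of \<open>H\<close>.\<close>

lemma dissipative_diff_image:
  assumes "dissipative t H" "pd (Im_matrix W)"
  shows "dissipative t (H - S W)"
  unfolding dissipative_def
proof
  fix v
  show "Im (quad_form (H - S W) v) \<le> - t * (norm v)\<^sup>2"
    using assms(1)[unfolded dissipative_def, rule_format, of v]
      Im_quad_form_image_nonneg[OF clinear positive assms(2), of v]
    by (simp add: quad_form_diff)
qed

lemma pd_resolvent:
  "0 < t \<Longrightarrow> dissipative t H \<Longrightarrow> pd (Im_matrix W) \<Longrightarrow> pd (Im_matrix (resolvent H W))"
  unfolding resolvent_def by (rule pd_Im_matrix_inv[OF _ dissipative_diff_image])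

lemma spectral_norm_resolvent_le:
  "0 < t \<Longrightarrow> dissipative t H \<Longrightarrow> pd (Im_matrix W) \<Longrightarrow> spectral_norm (resolvent H W) \<le> 1 / t"
  unfolding resolvent_def by (rule spectral_norm_inv_dissipative[OF _ dissipative_diff_image])

lemma pd_funpow_resolvent:
  assumes "0 < t" "dissipative t H" "pd (Im_matrix W)"
  shows "pd (Im_matrix ((resolvent H ^^ k) W))"
  by (induction k) (use assms pd_resolvent in auto)

lemma matrix_holomorphic_on_resolvent:
  assumes "matrix_holomorphic_on H U" "matrix_holomorphic_on G U"
    and "\<And>w. w \<in> U \<Longrightarrow> 0 < t w" "\<And>w. w \<in> U \<Longrightarrow> dissipative (t w) (H w)"
    and "\<And>w. w \<in> U \<Longrightarrow> pd (Im_matrix (G w))"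
  shows "matrix_holomorphic_on (\<lambda>w. resolvent (H w) (G w)) U"
  unfolding resolvent_def
proof (rule matrix_holomorphic_on_inv)
  show "matrix_holomorphic_on (\<lambda>w. H w - S (G w)) U"
    by (rule matrix_holomorphic_on_diff[OF assms(1) matrix_holomorphic_on_clinear[OF clinear assms(2)]])
  show "invertible (H w - S (G w))" if "w \<in> U" for w
    using dissipative_invertible[OF assms(3)[OF that] dissipative_diff_image] assms(4,5)[OF that]
    by blast
qed

text \<open>By the resolvent identity the difference is a product with two resolvents, each of norm
  at most \<open>1 / t\<close>. The map is thus a contraction once
  \<open>t\<^sup>2 > s\<close>.\<close>

lemma spectral_norm_resolvent_diff_le:
  assumes "0 < t" "dissipative t H" "pd (Im_matrix X)" "pd (Im_matrix Y)"
  shows "spectral_norm (resolvent H X - resolvent H Y) \<le> s / t\<^sup>2 * spectral_norm (X - Y)"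
proof -
  have "invertible (H - S X)" "invertible (H - S Y)"
    using assms dissipative_invertible dissipative_diff_image by blast+
  from matrix_inv_diff[OF this]
  have eq: "resolvent H X - resolvent H Y = resolvent H X ** S (X - Y) ** resolvent H Y"
    by (simp add: resolvent_def matrix_clinear_diff[OF clinear])
  have "spectral_norm (resolvent H X - resolvent H Y)
      \<le> spectral_norm (resolvent H X) * spectral_norm (S (X - Y)) * spectral_norm (resolvent H Y)"
    unfolding eq
    by (intro order_trans[OF spectral_norm_mult_le] mult_right_mono spectral_norm_mult_le
          spectral_norm_nonneg)
  also have "\<dots> \<le> 1 / t * (s * spectral_norm (X - Y)) * (1 / t)"
    using assms bounded[of "X - Y"] spectral_norm_resolvent_le[of t H]
      order_trans[OF spectral_norm_nonneg bounded[of "X - Y"]]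
    by (intro mult_mono) (auto simp: spectral_norm_nonneg)
  finally show ?thesis by (simp add: power2_eq_square)
qed

text \<open>This embeds the equation, which is the case \<open>w = \<i> * \<tau>\<close>, into a
  family depending holomorphically on \<open>w\<close> in the upper half-plane.\<close>

lemma dissipative_shift:
  assumes "dissipative 0 H"
  shows "dissipative (Im w) (H - mscale w (mat 1))"
  using assms
  by (simp add: dissipative_def quad_form_diff quad_form_mscale quad_form_mat_1 del: of_real_power)

text \<open>
  For large \<open>Im w\<close> the resolvent map is a contraction; normal families carry the conclusion over
  to the whole half-plane.
\<close>

lemma resolvent_iterates_merge:
  assumes H: "dissipative 0 H" and X: "pd (Im_matrix X)" and Y: "pd (Im_matrix Y)"
    and w: "0 < Im w"
  defines "\<Phi> \<equiv> \<lambda>w. resolvent (H - mscale w (mat 1))"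
  shows "(\<lambda>k. cinner u ((\<Phi> w ^^ k) X *v v) - cinner u ((\<Phi> w ^^ k) Y *v v)) \<longlonglongrightarrow> 0"
proof -
  note diss = dissipative_shift[OF H]
  have pd: "pd (Im_matrix ((\<Phi> w ^^ k) W))" if "0 < Im w" "pd (Im_matrix W)" for k w W
    unfolding \<Phi>_def by (rule pd_funpow_resolvent[OF that(1) diss that(2)])
  have le: "spectral_norm ((\<Phi> w ^^ Suc k) W) \<le> 1 / Im w" if "0 < Im w" "pd (Im_matrix W)" for k w W
    using spectral_norm_resolvent_le[OF that(1) diss pd[OF that]] by (simp add: \<Phi>_def)
  have hol: "matrix_holomorphic_on (\<lambda>w. (\<Phi> w ^^ k) W) {w. 0 < Im w}" if "pd (Im_matrix W)" for k W
  proof (induction k)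
    case (Suc k)
    have "matrix_holomorphic_on (\<lambda>w. \<Phi> w ((\<Phi> w ^^ k) W)) {w. 0 < Im w}"
      unfolding \<Phi>_def
    proof (rule matrix_holomorphic_on_resolvent[where t = Im])
      show "matrix_holomorphic_on (\<lambda>w. H - mscale w (mat 1)) {w. 0 < Im w}"
        by (rule matrix_holomorphic_on_diff[OF matrix_holomorphic_on_const
              matrix_holomorphic_on_mscale[OF holomorphic_on_ident]])
      show "matrix_holomorphic_on (\<lambda>w. (resolvent (H - mscale w (mat 1)) ^^ k) W) {w. 0 < Im w}"
        using Suc unfolding \<Phi>_def .
      show "pd (Im_matrix ((resolvent (H - mscale w (mat 1)) ^^ k) W))" if "w \<in> {w. 0 < Im w}" for w
        using pd[of w W k] that \<open>pd (Im_matrix W)\<close> unfolding \<Phi>_def by simp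
    qed (simp_all add: diss)
    then show ?case by simp
  qed (simp add: matrix_holomorphic_on_const)
  \<comment> \<open>The index starts at one because the bound \<open>1 / Im w\<close> is available
    only after \<open>\<Phi> w\<close> has been applied once.\<close>
  define f where
    "f k w = cinner u ((\<Phi> w ^^ Suc k) X *v v) - cinner u ((\<Phi> w ^^ Suc k) Y *v v)" for k w
  have "(\<lambda>k. f k w) \<longlonglongrightarrow> 0"
  proof (rule vitali_tendsto_0)
    show "open {w. 0 < Im w}" by (rule open_halfspace_Im_gt)
    show "connected {w. 0 < Im w}" by (intro convex_connected convex_halfspace_Im_gt)
    show "f k holomorphic_on {w. 0 < Im w}" for k
      unfolding f_def by (intro holomorphic_intros holomorphic_on_cinner hol X Y)
    show "\<exists>B. \<forall>k. \<forall>w\<in>K. cmod (f k w) \<le> B" if K: "compact K" "K \<subseteq> {w. 0 < Im w}" for K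
    proof -
      have "continuous_on K (\<lambda>w. 2 * (1 / Im w * (norm u * norm v)))"
        using K(2) by (auto intro!: continuous_intros)
      then have "bounded ((\<lambda>w. 2 * (1 / Im w * (norm u * norm v))) ` K)"
        using compact_continuous_image K(1) compact_imp_bounded by blast
      then obtain B where B: "\<And>w. w \<in> K \<Longrightarrow> norm (2 * (1 / Im w * (norm u * norm v))) \<le> B"
        unfolding bounded_iff by auto
      have "cmod (f k w) \<le> B" if "w \<in> K" for k w
      proof -
        have w: "0 < Im w" using that K(2) by auto
        have "cmod (cinner u ((\<Phi> w ^^ Suc k) W *v v)) \<le> 1 / Im w * (norm u * norm v)"
          if "pd (Im_matrix W)" for W
          by (rule order_trans[OF norm_cinner_mult_le mult_right_mono[OF le[OF w that]]]) simp
        from this[OF X] this[OF Y] have "cmod (f k w) \<le> 2 * (1 / Im w * (norm u * norm v))"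
          unfolding f_def by (intro order_trans[OF norm_triangle_ineq4]) linarith
        also have "\<dots> \<le> B" using B[OF that] unfolding real_norm_def by linarith
        finally show ?thesis .
      qed
      then show ?thesis by blast
    qed
    \<comment> \<open>On this half-plane \<open>2 * s < Im w \<le> (Im w)\<^sup>2\<close>, so the
      Lipschitz constant \<open>s / (Im w)\<^sup>2\<close> is at most 1/2.\<close>
    show "open {w. max 1 (2 * s) < Im w}" by (rule open_halfspace_Im_gt)
    show "{w. max 1 (2 * s) < Im w} \<noteq> {}"
    proof -
      have "Complex 0 (2 * \<bar>s\<bar> + 2) \<in> {w. max 1 (2 * s) < Im w}" by auto
      then show ?thesis by blast
    qed
    show "{w. max 1 (2 * s) < Im w} \<subseteq> {w. 0 < Im w}" by auto
    show "(\<lambda>k. f k w) \<longlonglongrightarrow> 0" if "w \<in> {w. max 1 (2 * s) < Im w}" for w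
    proof -
      have w: "1 < Im w" "2 * s < Im w" using that by auto
      have "Im w \<le> (Im w)\<^sup>2" using w(1) by (simp add: power2_eq_square)
      then have q: "s / (Im w)\<^sup>2 \<le> 1 / 2" using w by (simp add: field_simps)
      have contr: "spectral_norm ((\<Phi> w ^^ k) X - (\<Phi> w ^^ k) Y) \<le> (1 / 2) ^ k * spectral_norm (X - Y)"
        for k
      proof (induction k)
        case (Suc k)
        have "spectral_norm (\<Phi> w ((\<Phi> w ^^ k) X) - \<Phi> w ((\<Phi> w ^^ k) Y))
            \<le> s / (Im w)\<^sup>2 * spectral_norm ((\<Phi> w ^^ k) X - (\<Phi> w ^^ k) Y)"
          using spectral_norm_resolvent_diff_le[OF _ diss] pd X Y w(1) by (simp add: \<Phi>_def)
        also have "\<dots> \<le> 1 / 2 * ((1 / 2) ^ k * spectral_norm (X - Y))"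
          by (rule mult_mono[OF q Suc]) (auto simp: spectral_norm_nonneg)
        finally show ?case by simp
      qed simp
      have "cmod (f k w) \<le> (1 / 2) ^ k * (spectral_norm (X - Y) * (norm u * norm v))" for k
      proof -
        have "f k w = cinner u (((\<Phi> w ^^ Suc k) X - (\<Phi> w ^^ Suc k) Y) *v v)"
          unfolding f_def by (simp only: matrix_vector_mult_diff_rdistrib cinner_diff)
        then have "cmod (f k w)
            \<le> spectral_norm ((\<Phi> w ^^ Suc k) X - (\<Phi> w ^^ Suc k) Y) * (norm u * norm v)"
          by (simp only: norm_cinner_mult_le)
        also have "\<dots> \<le> (1 / 2) ^ Suc k * spectral_norm (X - Y) * (norm u * norm v)"
          by (intro mult_right_mono contr) simp
        also have "\<dots> \<le> (1 / 2) ^ k * spectral_norm (X - Y) * (norm u * norm v)"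
          by (intro mult_right_mono) (auto simp: spectral_norm_nonneg)
        finally show ?thesis by (simp add: mult.assoc)
      qed
      moreover have "(\<lambda>k. (1 / 2) ^ k * (spectral_norm (X - Y) * (norm u * norm v))) \<longlonglongrightarrow> 0"
        by (rule tendsto_mult_left_zero[OF LIMSEQ_power_zero]) simp
      ultimately show ?thesis
        by (rule Lim_null_comparison[OF always_eventually[OF allI]])
    qed
  qed (use w in simp)
  then show ?thesis
    unfolding f_def by (rule LIMSEQ_imp_Suc[where f = "\<lambda>k. cinner u ((\<Phi> w ^^ k) X *v v) - cinner u ((\<Phi> w ^^ k) Y *v v)"])
qed

text \<open>
  The iterates \<open>G k \<zeta>\<close> of \<open>W \<mapsto> resolvent H W + \<zeta> (F - resolvent H F)\<close> from \<open>F\<close> are constant at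
  \<open>\<zeta> = 1\<close> and are the resolvent iterates, which tend to \<open>M\<close>, at \<open>\<zeta> = 0\<close>.
\<close>

lemma fixed_point_perturbation:
  assumes H: "dissipative 0 H" and t: "0 < t"
  defines "\<Phi> \<equiv> resolvent (H - mscale (\<i> * of_real t) (mat 1))"
  assumes M: "pd (Im_matrix M)" "\<Phi> M = M"
    and F: "pd (Im_matrix F)" "spectral_norm F < b"
    and m: "0 < m" "\<And>W. pd (Im_matrix W) \<Longrightarrow> spectral_norm W < b
          \<Longrightarrow> spectral_norm (H - mscale (\<i> * of_real t) (mat 1) - S W) \<le> m"
    and b: "1 / t + t / m\<^sup>2 \<le> b"
    and R: "1 < R" "R * spectral_norm (F - \<Phi> F) \<le> t / m\<^sup>2"
  shows "spectral_norm (M - F) \<le> (b + 1 / t) / R"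
proof -
  define \<delta> where "\<delta> = F - \<Phi> F"
  define G where "G k \<zeta> = ((\<lambda>W. \<Phi> W + mscale \<zeta> \<delta>) ^^ k) F" for k \<zeta>
  have G_Suc: "G (Suc k) \<zeta> = \<Phi> (G k \<zeta>) + mscale \<zeta> \<delta>" for k \<zeta>
    by (simp add: G_def)
  have diss: "dissipative t (H - mscale (\<i> * of_real t) (mat 1))"
    using dissipative_shift[OF H, of "\<i> * of_real t"] by simp
  \<comment> \<open>If \<delta> vanishes, multiplying \<open>cmod \<zeta> < R\<close> by its norm
    loses strictness, hence the separate case.\<close>
  have small: "cmod \<zeta> * spectral_norm \<delta> < t / m\<^sup>2" if "cmod \<zeta> < R" for \<zeta>
  proof (cases "spectral_norm \<delta> = 0")
    case True
    then show ?thesis using t m(1) by simp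
  next
    case False
    then have "cmod \<zeta> * spectral_norm \<delta> < R * spectral_norm \<delta>"
      using that spectral_norm_nonneg[of \<delta>] by (intro mult_strict_right_mono) auto
    with R(2) show ?thesis unfolding \<delta>_def by linarith
  qed
  \<comment> \<open>The iterates never leave the domain: the perturbation is smaller than the margin
    \<open>t / m\<^sup>2\<close> by which the imaginary part of \<Phi> is positive, and the norm
    stays below \<open>1 / t + t / m\<^sup>2\<close>.\<close>
  have G: "pd (Im_matrix (G k \<zeta>)) \<and> spectral_norm (G k \<zeta>) < b" if \<zeta>: "cmod \<zeta> < R" for k \<zeta>
  proof (induction k)
    case 0
    then show ?case using F by (simp add: G_def)
  next
    case (Suc k)
    have "0 < Im (quad_form (G (Suc k) \<zeta>) v)" if "v \<noteq> 0" for v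
    proof -
      have "- Im (\<zeta> * quad_form \<delta> v) \<le> cmod (\<zeta> * quad_form \<delta> v)"
        by (metis abs_Im_le_cmod abs_le_D2)
      also have "\<dots> \<le> cmod \<zeta> * (spectral_norm \<delta> * (norm v * norm v))"
        unfolding norm_mult quad_form_cinner by (intro mult_left_mono norm_cinner_mult_le) simp
      also have "\<dots> = cmod \<zeta> * spectral_norm \<delta> * (norm v)\<^sup>2"
        by (simp add: power2_eq_square)
      also have "\<dots> < t / m\<^sup>2 * (norm v)\<^sup>2"
        using small[OF \<zeta>] that by (intro mult_strict_right_mono) auto
      also have "\<dots> \<le> Im (quad_form (\<Phi> (G k \<zeta>)) v)"
        unfolding \<Phi>_def resolvent_def using Suc m t
        by (intro Im_quad_form_inv_ge dissipative_diff_image diss) auto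
      finally show ?thesis by (simp add: G_Suc quad_form_add quad_form_mscale)
    qed
    moreover have "spectral_norm (G (Suc k) \<zeta>) < b"
    proof -
      have "spectral_norm (G (Suc k) \<zeta>) \<le> spectral_norm (\<Phi> (G k \<zeta>)) + cmod \<zeta> * spectral_norm \<delta>"
        unfolding G_Suc using spectral_norm_add_le spectral_norm_mscale_le
        by (meson add_left_mono order_trans)
      also have "\<dots> < 1 / t + t / m\<^sup>2"
        unfolding \<Phi>_def using spectral_norm_resolvent_le[OF t diss] Suc small[OF \<zeta>]
        by (intro add_le_less_mono) auto
      finally show ?thesis using b by linarith
    qed
    ultimately show ?case unfolding pd_Im_matrix_iff by blast
  qed
  have hol: "matrix_holomorphic_on (G k) (ball 0 R)" for k
  proof (induction k)
    case (Suc k)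
    have "matrix_holomorphic_on (\<lambda>\<zeta>. \<Phi> (G k \<zeta>)) (ball 0 R)"
      unfolding \<Phi>_def
      by (rule matrix_holomorphic_on_resolvent[where t = "\<lambda>_. t"])
         (use Suc G t diss in \<open>auto simp: matrix_holomorphic_on_const\<close>)
    then show ?case
      unfolding G_Suc[abs_def]
      by (intro matrix_holomorphic_on_add matrix_holomorphic_on_mscale holomorphic_intros)
  qed (simp add: G_def matrix_holomorphic_on_const)
  \<comment> \<open>At \<zeta> = 1 the added term is exactly \<open>F - \<Phi> F\<close>, so
    \<open>F\<close> is a fixed point of the perturbed map.\<close>
  have G1: "G k 1 = F" for k
    by (induction k) (simp_all add: G_Suc, simp_all add: G_def \<delta>_def vec_eq_iff)
  have mscale_0: "mscale 0 \<delta> = 0" by (simp add: vec_eq_iff)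
  have G0: "G k 0 = (\<Phi> ^^ k) F" for k
    by (simp add: G_def mscale_0)
  have M_fix: "(\<Phi> ^^ k) M = M" for k
    by (induction k) (simp_all add: M(2))
  show ?thesis
  proof (rule spectral_norm_le_cinnerI)
    fix u v :: "complex ^ 'l"
    define c where "c = norm u * norm v"
    show "cmod (cinner u ((M - F) *v v)) \<le> (b + 1 / t) / R * (norm u * norm v)"
    \<comment> \<open>The Schwarz estimate needs a strict bound, which requires
      \<open>norm u * norm v\<close> to be positive.\<close>
    proof (cases "u = 0 \<or> v = 0")
      case True
      then show ?thesis by (auto simp: cinner_def)
    next
      case False
      then have c: "0 < c" by (simp add: c_def)
      \<comment> \<open>With \<open>Suc k\<close> the centre \<open>G (Suc k) 0\<close> is a value
        of \<Phi>, of norm at most \<open>1 / t\<close>; this gives the constant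
        \<open>b + 1 / t\<close> instead of \<open>2 * b\<close>.\<close>
      have "cmod (cinner u (F *v v) - cinner u ((\<Phi> ^^ Suc k) F *v v)) \<le> (b + 1 / t) * c / R" for k
      proof -
        have "cmod (cinner u (G (Suc k) \<zeta> *v v) - cinner u (G (Suc k) 0 *v v)) < (b + 1 / t) * c"
          if \<zeta>: "cmod \<zeta> < R" for \<zeta>
        proof -
          have "cmod (cinner u (G (Suc k) \<zeta> *v v)) < b * c"
            using G[OF \<zeta>, of "Suc k"] c unfolding c_def
            by (intro le_less_trans[OF norm_cinner_mult_le mult_strict_right_mono]) auto
          moreover have "spectral_norm (G (Suc k) 0) \<le> 1 / t"
            using spectral_norm_resolvent_le[OF t diss] G[of 0 k] R(1)
            by (simp add: G_Suc mscale_0 \<Phi>_def)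
          then have "cmod (cinner u (G (Suc k) 0 *v v)) \<le> 1 / t * c"
            unfolding c_def by (intro order_trans[OF norm_cinner_mult_le mult_right_mono]) auto
          ultimately show ?thesis
            by (intro le_less_trans[OF norm_triangle_ineq4]) (simp add: distrib_right)
        qed
        from schwarz_increment[OF holomorphic_on_cinner[OF hol] R(1) this]
        show ?thesis unfolding G1 G0 .
      qed
      moreover have "(\<lambda>k. cinner u (F *v v) - cinner u ((\<Phi> ^^ Suc k) F *v v))
          \<longlonglongrightarrow> cinner u (F *v v) - cinner u (M *v v)"
      proof -
        \<comment> \<open>The iterates from \<open>M\<close> are constant, so those from
          \<open>F\<close> must converge to \<open>M\<close>; the spectral parameter here is
          \<open>\<i> * t\<close>.\<close>
        have "(\<lambda>k. cinner u ((\<Phi> ^^ k) M *v v) - cinner u ((\<Phi> ^^ k) F *v v)) \<longlonglongrightarrow> 0"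
          unfolding \<Phi>_def by (rule resolvent_iterates_merge[OF H M(1) F(1)]) (simp add: t)
        from tendsto_diff[OF this[unfolded M_fix] tendsto_const[of "cinner u (M *v v) - cinner u (F *v v)"]]
        show ?thesis by (intro LIMSEQ_Suc) simp
      qed
      ultimately have "cmod (cinner u (F *v v) - cinner u (M *v v)) \<le> (b + 1 / t) * c / R"
        by (intro tendsto_upperbound[OF tendsto_norm]) auto
      then show ?thesis
        by (simp add: matrix_vector_mult_diff_rdistrib cinner_diff norm_minus_commute c_def)
    qed
  qed
qed

end


section \<open>The inverse hyperbolic tangent\<close>

lemma tanh_artanh_real:
  assumes "\<bar>x\<bar> < 1"
  shows "tanh (artanh x) = (x :: real)"
proof -
  define y where "y = (1 + x) / (1 - x)"
  have y: "0 < y" using assms by (simp add: y_def)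
  have "exp (- 2 * artanh x) = 1 / y"
    using y by (simp add: artanh_def y_def[symmetric] exp_minus inverse_eq_divide)
  then have "tanh (artanh x) = (1 - 1 / y) / (1 + 1 / y)"
    unfolding tanh_real_altdef by simp
  also have "\<dots> = x"
    using assms by (simp add: y_def field_simps)
  finally show ?thesis .
qed

text \<open>Monotonicity of tanh, starting from \<open>x = tanh (artanh x)\<close>. It passes from
  the linear Schwarz bound to the stated one.\<close>

lemma le_tanh_mult_artanh:
  assumes "0 \<le> x" "x < 1" "1 \<le> K"
  shows "x \<le> tanh (K * artanh (x :: real))"
proof -
  have "0 \<le> artanh x"
    using assms by (simp add: artanh_def)
  then have "artanh x \<le> K * artanh x"
    using assms(3) by (simp add: mult_le_cancel_right1)
  then have "tanh (artanh x) \<le> tanh (K * artanh x)" by simp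
  then show ?thesis using assms by (simp add: tanh_artanh_real)
qed

section \<open>The block projection, symmetry of the expectation and auxiliary matrix facts\<close>

lemma Lambda_mult_vec_nth: "(Lambda *v v) $ i = (case i of Inl a \<Rightarrow> v $ i | Inr b \<Rightarrow> 0)"
  for v :: "complex ^ ('n::finite + 'd::finite)"
proof -
  have "UNIV = range Inl \<union> (range Inr :: ('n + 'd) set)" by (rule UNIV_sum)
  then have "(\<Sum>j\<in>UNIV. f j) = (\<Sum>a\<in>UNIV. f (Inl a)) + (\<Sum>b\<in>UNIV. f (Inr b))"
    for f :: "'n + 'd \<Rightarrow> complex"
    by (subst sum.union_disjoint[symmetric, of "range Inl" "range Inr" f, THEN trans[rotated]])
      (auto simp: sum.reindex)
  then show ?thesis
    by (cases i) (simp_all add: Lambda_def block_matrix_def matrix_vector_mult_def mat_def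
        mult_delta_left)
qed

lemma spectral_norm_Lambda_le: "spectral_norm Lambda \<le> 1"
  by (rule spectral_norm_leI)
     (auto intro!: norm_le_componentwise_cart simp: Lambda_mult_vec_nth split: sum.split)

lemma quad_form_Lambda: "Im (quad_form Lambda v) = 0" "0 \<le> Re (quad_form Lambda v)"
proof -
  have "Im (cnj (v $ i) * (Lambda *v v) $ i) = 0 \<and> 0 \<le> Re (cnj (v $ i) * (Lambda *v v) $ i)" for i
    by (auto simp: Lambda_mult_vec_nth split: sum.split)
  then show "Im (quad_form Lambda v) = 0" "0 \<le> Re (quad_form Lambda v)"
    by (auto simp: quad_form_def sum_nonneg)
qed

lemma block_matrix_symmetric:
  assumes "transpose A = A" "transpose Q = Q"
  shows "transpose (block_matrix A (transpose B) B Q) = block_matrix A (transpose B) B Q"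
proof -
  have "A $ a $ b = A $ b $ a" "Q $ c $ d = Q $ d $ c" for a b c d
    using assms by (metis transpose_def vec_lambda_beta)+
  then show ?thesis
    by (auto simp: vec_eq_iff transpose_def block_matrix_def split: sum.split)
qed

text \<open>Transposition is its own bounded linear inverse, so it preserves integrability in both
  directions; otherwise both sides are zero by convention.\<close>

lemma transpose_integral:
  fixes f :: "'w \<Rightarrow> real ^ 'c::finite ^ 'r::finite"
  shows "transpose (integral\<^sup>L P f) = integral\<^sup>L P (\<lambda>\<omega>. transpose (f \<omega>))"
proof -
  have lin: "bounded_linear (transpose :: real ^ 'a::finite ^ 'b::finite \<Rightarrow> real ^ 'b ^ 'a)"
    unfolding linear_conv_bounded_linear[symmetric]
    by (rule linearI) (simp_all add: transpose_def vec_eq_iff)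
  show ?thesis
    by (rule integral_bounded_linear'[OF lin lin, symmetric]) simp
qed


lemma ctranspose_cmatrix: "ctranspose (cmatrix X) = cmatrix (transpose X)"
  by (simp add: vec_eq_iff cmatrix_def transpose_def)

lemma borel_measurable_matrixI:
  fixes f :: "'w \<Rightarrow> real ^ 'c::finite ^ 'r::finite"
  assumes "\<And>i j. (\<lambda>\<omega>. f \<omega> $ i $ j) \<in> borel_measurable P"
  shows "f \<in> borel_measurable P"
  by (subst borel_measurable_euclidean_space) (auto simp: Basis_vec_def inner_axis assms)

lemma spectral_norm_mat_1_le: "spectral_norm (mat 1) \<le> 1"
  by (rule spectral_norm_leI) simp

lemma matrix_inv_mult_eq:
  assumes "invertible N" "N ** X = Y"
  shows "X = matrix_inv N ** Y"
  by (simp add: assms matrix_mul_assoc matrix_inv_mult flip: assms(2))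

section \<open>Application to the regularised equation and the final estimate\<close>

theorem lemma5p6:
  fixes P :: "'w measure"
    and L :: "'w \<Rightarrow> real ^ ('n::finite + 'd::finite) ^ ('n + 'd)"
    and A :: "'w \<Rightarrow> real ^ 'n ^ 'n"
    and B :: "'w \<Rightarrow> real ^ 'n ^ 'd"
    and Q :: "'w \<Rightarrow> real ^ 'd ^ 'd"
    and EL :: "complex ^ ('n + 'd) ^ ('n + 'd)"
    and dA :: "'w \<Rightarrow> complex ^ 'n ^ 'n"
    and dB :: "'w \<Rightarrow> complex ^ 'n ^ 'd"
    and S :: "complex ^ ('n + 'd) ^ ('n + 'd) \<Rightarrow> complex ^ ('n + 'd) ^ ('n + 'd)"
    and S11 :: "complex ^ ('n + 'd) ^ ('n + 'd) \<Rightarrow> complex ^ 'n ^ 'n"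
    and M :: "complex \<Rightarrow> complex ^ ('n + 'd) ^ ('n + 'd)"
    and F D :: "complex ^ ('n + 'd) ^ ('n + 'd)"
    and s \<tau> b m\<^sub>b \<epsilon> :: real
    and z :: complex
  assumes P: "prob_space P"
    and L_blocks: "\<And>\<omega>. L \<omega> = block_matrix (A \<omega>) (transpose (B \<omega>)) (B \<omega>) (Q \<omega>)"
    and L_measurable: "\<And>i j. (\<lambda>\<omega>. L \<omega> $ i $ j) \<in> borel_measurable P"
    and L_second_moments: "\<And>i j. integrable P (\<lambda>\<omega>. (L \<omega> $ i $ j)\<^sup>2)"
    and A_symmetric: "AE \<omega> in P. transpose (A \<omega>) = A \<omega>"
    and Q_symmetric: "AE \<omega> in P. transpose (Q \<omega>) = Q \<omega>"
    and Q_nonsingular: "AE \<omega> in P. invertible (Q \<omega>)"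
    and EQ_nonsingular: "invertible (integral\<^sup>L P Q)"
    and EL_eq: "EL = cmatrix (integral\<^sup>L P L)"
    and dA_eq: "\<And>\<omega>. dA \<omega> = cmatrix (A \<omega> - integral\<^sup>L P A)"
    and dB_eq: "\<And>\<omega>. dB \<omega> = cmatrix (B \<omega> - integral\<^sup>L P B)"
    and S_linear: "matrix_clinear S"
    and S_positive: "positivity_preserving S"
    and S11_linear: "matrix_clinear S11"
    and S11_positive: "positivity_preserving S11"
    and S_form: "\<And>W. S W = block_matrix
          (S11 W)
          (integral\<^sup>L P (\<lambda>\<omega>. dA \<omega> ** block11 W ** transpose (dB \<omega>)))
          (integral\<^sup>L P (\<lambda>\<omega>. dB \<omega> ** block11 W ** dA \<omega>))
          (integral\<^sup>L P (\<lambda>\<omega>. dB \<omega> ** block11 W ** transpose (dB \<omega>)))"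
    and s_pos: "s > 0"
    and S_bounded: "\<And>W. spectral_norm (S W) \<le> s * spectral_norm W"
    and \<tau>_pos: "\<tau> > 0"
    and M_solution: "mde_solution EL S \<tau> M"
    and z: "Im z > 0"
    and b_eq: "b = 1 / \<tau> + 2 * \<tau>"
    and m\<^sub>b_eq: "m\<^sub>b = spectral_norm EL + s * b + cmod z + \<tau> + 1"
    and F_Im: "pd (Im_matrix F)"
    and F_norm: "spectral_norm F < b"
    and D_eq: "mde_op EL S z \<tau> F ** F = mat 1 + D"
    and \<epsilon>_eq: "\<epsilon> = spectral_norm (matrix_inv (mde_op EL S z \<tau> F) ** D)"
    and \<epsilon>_less: "\<epsilon> < \<tau> / m\<^sub>b\<^sup>2"
  shows "spectral_norm (M z - F)
     \<le> 2 * (\<tau> + 1 / \<tau>)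
         * tanh ((1 + \<tau>\<^sup>2) * (m\<^sub>b\<^sup>2 / \<tau>\<^sup>2 - 1) * artanh (\<epsilon> * m\<^sub>b\<^sup>2 / \<tau>))"
proof -
  \<comment> \<open>The term with \<tau> is left out of \<open>H\<close>, so that
    \<open>\<i> * \<tau>\<close> can act as the spectral parameter.\<close>
  define H where "H = EL - mscale z Lambda"
  define N where "N W = H - mscale (\<i> * of_real \<tau>) (mat 1) - S W" for W
  define \<Phi> where "\<Phi> W = matrix_inv (N W)" for W
  interpret mde_map S s
    by unfold_locales (fact S_linear, fact S_positive, fact S_bounded)
  have op: "mde_op EL S z \<tau> W = N W" for W
    by (simp add: mde_op_def N_def H_def algebra_simps)
  \<comment> \<open>Almost sure symmetry of \<open>L\<close> passes to its expectation, so
    \<open>EL\<close> is Hermitian.\<close>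
  have "integral\<^sup>L P (\<lambda>\<omega>. transpose (L \<omega>)) = integral\<^sup>L P L"
  proof (rule integral_cong_AE)
    show "AE \<omega> in P. transpose (L \<omega>) = L \<omega>"
      using A_symmetric Q_symmetric by eventually_elim (simp add: L_blocks block_matrix_symmetric)
  qed (auto intro!: borel_measurable_matrixI simp: transpose_def L_measurable)
  then have "ctranspose EL = EL"
    by (simp add: EL_eq ctranspose_cmatrix transpose_integral)
  \<comment> \<open>\<open>EL\<close> contributes a real form, and the term with
    \<open>Lambda\<close> contributes minus \<open>Im z\<close> times a nonnegative number.\<close>
  then have H: "dissipative 0 H"
    using z by (simp add: dissipative_def H_def quad_form_diff quad_form_mscale
        Im_quad_form_hermitian quad_form_Lambda)
  have "dissipative \<tau> (H - mscale (\<i> * of_real \<tau>) (mat 1))"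
    using dissipative_shift[OF H, of "\<i> * of_real \<tau>"] by simp
  then have inv: "invertible (N W)" if "pd (Im_matrix W)" for W
    unfolding N_def using dissipative_invertible[OF \<tau>_pos] dissipative_diff_image that by blast
  have M: "pd (Im_matrix (M z))" "N (M z) ** M z = mat 1"
    using M_solution z unfolding mde_solution_def op[symmetric] by blast+
  have \<Phi>_M: "\<Phi> (M z) = M z"
    using matrix_inv_mult_eq[OF inv[OF M(1)] M(2)] by (simp add: \<Phi>_def)
  \<comment> \<open>Multiplying the perturbed equation by the inverse of \<open>N F\<close> gives
    \<open>F = \<Phi> F + matrix_inv (N F) ** D\<close>, which identifies \<epsilon> as the
    fixed-point defect of \<open>F\<close>.\<close>
  have "matrix_inv (N F) ** (mat 1 + D) = F"
    using matrix_inv_mult_eq[OF inv[OF F_Im] D_eq[unfolded op]] ..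
  then have "\<Phi> F + matrix_inv (N F) ** D = F"
    by (simp only: \<Phi>_def matrix_add_ldistrib matrix_mul_rid)
  then have "F - \<Phi> F = matrix_inv (N F) ** D"
    by (metis add_diff_cancel_left')
  then have \<epsilon>: "spectral_norm (F - \<Phi> F) = \<epsilon>"
    by (simp add: \<epsilon>_eq op)
  have \<epsilon>_nonneg: "0 \<le> \<epsilon>"
    unfolding \<epsilon>_eq by (rule spectral_norm_nonneg)
  have b: "0 < b" unfolding b_eq using \<tau>_pos by (intro add_pos_pos) auto
  have m: "1 + \<tau> \<le> m\<^sub>b"
    unfolding m\<^sub>b_eq using spectral_norm_nonneg[of EL] s_pos b by simp
  \<comment> \<open>The summands of \<open>m\<^sub>b\<close> other than 1 bound the four terms of
    \<open>N W\<close> one by one.\<close>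
  have N_le: "spectral_norm (N W) \<le> m\<^sub>b" if "spectral_norm W < b" for W
  proof -
    have "spectral_norm (N W) \<le> spectral_norm EL + spectral_norm (mscale z Lambda :: complex ^ ('n + 'd) ^ ('n + 'd))
        + spectral_norm (mscale (\<i> * of_real \<tau>) (mat 1 :: complex ^ ('n + 'd) ^ ('n + 'd)))
        + spectral_norm (S W)"
      unfolding N_def H_def
      by (intro order_trans[OF spectral_norm_diff_le] add_right_mono) simp
    moreover have "spectral_norm (mscale z Lambda :: complex ^ ('n + 'd) ^ ('n + 'd)) \<le> cmod z"
      using order_trans[OF spectral_norm_mscale_le mult_left_mono[OF spectral_norm_Lambda_le]] by simp
    moreover have "spectral_norm (mscale (\<i> * of_real \<tau>) (mat 1 :: complex ^ ('n + 'd) ^ ('n + 'd))) \<le> \<tau>"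
      by (rule order_trans[OF spectral_norm_mscale_le])
         (use \<tau>_pos in \<open>simp add: norm_mult spectral_norm_mat_1_le\<close>)
    moreover have "spectral_norm (S W) \<le> s * b"
      using order_trans[OF S_bounded mult_left_mono[OF less_imp_le[OF that] less_imp_le[OF s_pos]]] .
    ultimately show ?thesis unfolding m\<^sub>b_eq by linarith
  qed
  \<comment> \<open>This is the reciprocal of the critical radius, and the argument of the inverse
    hyperbolic tangent in the claim.\<close>
  define x where "x = \<epsilon> * m\<^sub>b\<^sup>2 / \<tau>"
  have x: "0 \<le> x" "x < 1"
    using \<epsilon>_nonneg \<epsilon>_less \<tau>_pos m by (simp_all add: x_def field_simps)
  have "1 / \<tau> + \<tau> / m\<^sub>b\<^sup>2 \<le> b"
  proof -
    have "1 \<le> m\<^sub>b\<^sup>2" using m \<tau>_pos by (intro one_le_power) simp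
    then have "\<tau> / m\<^sub>b\<^sup>2 \<le> \<tau> / 1" using \<tau>_pos by (intro divide_left_mono) auto
    then show ?thesis unfolding b_eq using \<tau>_pos by simp
  qed
  note perturb = fixed_point_perturbation[OF H \<tau>_pos M(1) _ F_Im F_norm _ _ this]
  have c: "0 < b + 1 / \<tau>" using b \<tau>_pos by (intro add_pos_pos) auto
  have "spectral_norm (M z - F) / (b + 1 / \<tau>) \<le> x"
  \<comment> \<open>The radius \<open>1 / x\<close> has no meaning when \<epsilon> = 0, so the
    radius \<open>1 / y\<close> is taken for every \<open>y\<close> strictly between
    \<open>x\<close> and 1, and the bound passes to the infimum.\<close>
  proof (rule dense_ge_bounded[OF x(2)])
    fix y assume y: "x < y" "y < 1"
    have "0 < y" using x(1) y(1) by linarith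
    moreover have "0 < m\<^sub>b\<^sup>2" using m \<tau>_pos by simp
    moreover have "\<epsilon> * m\<^sub>b\<^sup>2 \<le> \<tau> * y"
      using y(1) \<tau>_pos by (simp add: x_def field_simps)
    ultimately have "1 / y * \<epsilon> \<le> \<tau> / m\<^sub>b\<^sup>2"
      by (simp add: pos_divide_le_eq pos_le_divide_eq)
    have "spectral_norm (M z - F) \<le> (b + 1 / \<tau>) / (1 / y)"
    proof (rule perturb)
      show "1 / y * spectral_norm (F - resolvent (H - mscale (\<i> * of_real \<tau>) (mat 1)) F)
          \<le> \<tau> / m\<^sub>b\<^sup>2"
        using \<open>1 / y * \<epsilon> \<le> \<tau> / m\<^sub>b\<^sup>2\<close>
        unfolding \<epsilon>[symmetric] unfolding \<Phi>_def N_def resolvent_def .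
    qed (use \<Phi>_M y x m \<tau>_pos N_le in \<open>auto simp: \<Phi>_def N_def resolvent_def\<close>)
    then show "spectral_norm (M z - F) / (b + 1 / \<tau>) \<le> y"
      using c by (simp add: pos_divide_le_eq mult.commute)
  qed
  then have "spectral_norm (M z - F) \<le> (b + 1 / \<tau>) * x"
    using c by (simp add: pos_divide_le_eq mult.commute)
  also have "b + 1 / \<tau> = 2 * (\<tau> + 1 / \<tau>)"
    by (simp add: b_eq)
  also have "2 * (\<tau> + 1 / \<tau>) * x
      \<le> 2 * (\<tau> + 1 / \<tau>) * tanh ((1 + \<tau>\<^sup>2) * (m\<^sub>b\<^sup>2 / \<tau>\<^sup>2 - 1) * artanh x)"
  proof (intro mult_left_mono le_tanh_mult_artanh x)
    \<comment> \<open>From \<open>m\<^sub>b \<ge> 1 + \<tau>\<close> follows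
      \<open>m\<^sub>b\<^sup>2 / \<tau>\<^sup>2 - 1 \<ge> 1 / \<tau>\<^sup>2\<close>, so the factor
      in front of artanh is at least \<open>1 + 1 / \<tau>\<^sup>2\<close>.\<close>
    have "(1 + \<tau>)\<^sup>2 \<le> m\<^sub>b\<^sup>2" using m \<tau>_pos by (intro power_mono) auto
    then have "1 + \<tau>\<^sup>2 \<le> m\<^sub>b\<^sup>2" using \<tau>_pos by (simp add: power2_sum)
    then have "1 / \<tau>\<^sup>2 \<le> m\<^sub>b\<^sup>2 / \<tau>\<^sup>2 - 1"
      using \<tau>_pos by (simp add: field_simps)
    then have "(1 + \<tau>\<^sup>2) * (1 / \<tau>\<^sup>2) \<le> (1 + \<tau>\<^sup>2) * (m\<^sub>b\<^sup>2 / \<tau>\<^sup>2 - 1)"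
      by (intro mult_left_mono) auto
    moreover have "1 \<le> (1 + \<tau>\<^sup>2) * (1 / \<tau>\<^sup>2)"
      using \<tau>_pos by (simp add: field_simps)
    ultimately show "1 \<le> (1 + \<tau>\<^sup>2) * (m\<^sub>b\<^sup>2 / \<tau>\<^sup>2 - 1)" by linarith
  qed (use \<tau>_pos in auto)
  finally show ?thesis unfolding x_def .
qed

end
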